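(* The canonical injection $\iota_{\mathcal I}:\mathcal I\to\overline{\mathcal I}$, $x\mapsto[\{x\}]$, satisfies $\iota_{\mathcal I}^{-1}(\mathcal V(F,U))=\widehat{F+U}$ for all $U\in\mathcal U$ and $F\in\mathcal F_{\mathcal I}$. Moreover it is continuous, open, and has dense image.
   Context: Building. $\mathcal I$ is an affine building with its complete system of apartments $\mathcal A$, identified with its affine geometric realization: a complete metric space in which every apartment $A$ is a Euclidean affine space cut into facets by a locally finite family of hyperplanes (walls); $W(A)$ is the affine Coxeter group generated by the orthogonal reflections in the walls. Isomorphisms between apartments are the type-preserving ones; they are isometries, and two isomorphisms $A\to B$ differ by an element of $W(A)$. A half-apartment is a closed half-space of $A$ bounded by a wall. $\vec A$ is the direction space of $A$ and $W(\vec A)$ the finite group of linear parts of elements of $W(A)$; the walls of $\vec A$ are the directions of the walls of $A$; they partition $\vec A$ into Weyl facets (the open ones are the Weyl chambers). Cones in apartments. Fix an apartment $A_0$ and a set $\mathcal F$ of nonempty subsets of $\vec A_0$ such that: (i) $\vec A_0$ is the disjoint union of the elements of $\mathcal F$; (ii) $\mathcal F$ is finite; (iii) $\{0\}\in\mathcal F$; (iv) each $\vec f\in\mathcal F$ is the solution set of a finite system of linear conditions $\alpha_i=0$, $\alpha_j>0$ (so it is a convex cone, open in its linear span); (v) $\overline{\vec f}\setminus\vec f$ is a union of other elements of $\mathcal F$, called faces of $\vec f$; (vi) if $\vec f$ is a face of $\vec g$, then $\overline{\vec f}=\mathrm{Vect}(\vec f)\cap\overline{\vec g}$; (vii) $\mathcal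 F$ is stable under $W(\vec A_0)$. Via any isomorphism $A_0\to A$, $\mathcal F$ is transported to a well-defined set, still denoted $\mathcal F$, of cones in $\vec A$, for every apartment $A$; likewise $\mathcal U$, the set of $W(\vec A_0)$-stable neighbourhoods of $0$ in $\vec A_0$. $\mathcal F_A$ is the set of cones $f=s+\vec f$, $s\in A$, $\vec f\in\mathcal F$ a cone of $\vec A$; $s=s(f)$ is the vertex of $f$. The heart of $\vec f$ is $\delta(\vec f)=\{x\in\vec f: wx=x\ \forall w\in \mathrm{Stab}_{W(\vec A)}(\vec f)\}$ (a nonempty convex cone contained in a Weyl facet), and $\delta(s+\vec f)=s+\delta(\vec f)$. Put $\delta(f)^*_A=s(f)+\bigcup\overline{\vec C}$, union over the Weyl chambers $\vec C$ of $\vec A$ with $\delta(\vec f)\subset\overline{\vec C}$. Cones in the building. For $f\in\mathcal F_A$ put $\tilde f=\bigcup_{B\in\mathcal A,\ \delta(f)\subset B}\phi_B(f)$, where $\phi_B:A\to B$ is any isomorphism fixing $\delta(f)$; $\mathcal F_{\mathcal I}$ is the set of all such $\tilde f$. The heart $\delta(\tilde f):=\delta(f)$ depends only on $\tilde f$. Given cones $a+\vec\gamma$ in apartments, with $\vec\gamma$ contained in a Weyl facet, a parallel subcone is a subcone $a'+\vec\gamma$; two such cones are parallel if parallel subcones of them are contained in a common apartment and are translates of each other there (two such cones always have parallel subcones in a common apartment). $F,G\in\mathcal F_{\mathcal I}$ are parallel if $\delta(F)$ and $\delta(G)$ are; $F$ is a parallel subcone of $G$ if $F\subset G$ and $F,G$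 are parallel; $F\sim G$ if some $H\in\mathcal F_{\mathcal I}$ is a parallel subcone of both. This is an equivalence relation, and $\overline{\mathcal I}=\mathcal F_{\mathcal I}/\!\sim$; $[F]$ is the class of $F$. Topology. For $F\in\mathcal F_{\mathcal I}$ with $\delta(F)\subset A$, and $a$ the vertex of $\delta(F)$, the base $b(F)$ is the intersection of $\delta(F)$ with all half-apartments of $A$ containing a neighbourhood of $a$ in $\delta(F)$ (independent of $A$). With $f=A\cap F\in\mathcal F_A$ and $U\in\mathcal U$ put $\widehat{F+U}=\bigcup_{B\in\mathcal A,\ B\supset b(F)}\phi_B\big((f+U)\cap\delta(f)^*_A\big)$, where $\phi_B:A\to B$ is any isomorphism fixing $b(F)$ (independent of choices). Put $\mathcal V(F,U)=\{x\in\overline{\mathcal I}: \text{some representative of } x \text{ is contained in }\widehat{F+U}\}$. $\overline{\mathcal I}$ has the unique topology for which, for each $x$, the sets $\mathcal V(F,U)$ with $F\in x$, $U\in\mathcal U$ form a base of neighbourhoods of $x$. *)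

theory Defs
  imports "HOL-Analysis.Analysis"
begin

section \<open>The model apartment\<close>

text \<open>The model apartment is a Euclidean space with a set of affine hyperplanes, the walls. A wall
  is a set of points, so no choice of normal vectors is made.\<close>

definition hyperplane_reflection :: "'a::euclidean_space \<Rightarrow> real \<Rightarrow> 'a \<Rightarrow> 'a" where
  "hyperplane_reflection n c x = x - (2 * (n \<bullet> x - c) / (n \<bullet> n)) *\<^sub>R n"

inductive_set wall_group :: "'a::euclidean_space set set \<Rightarrow> ('a \<Rightarrow> 'a) set" for Hs where
  wall_group_id: "id \<in> wall_group Hs"
| wall_group_refl: "\<lbrakk>n \<noteq> 0; {x. n \<bullet> x = c} \<in> Hs; w \<in> wall_group Hs\<rbrakk>
    \<Longrightarrow> hyperplane_reflection n c \<circ> w \<in> wall_group Hs"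

definition vector_wall_group :: "'a::euclidean_space set set \<Rightarrow> ('a \<Rightarrow> 'a) set" where
  "vector_wall_group Hs = (\<lambda>w v. w v - w 0) ` wall_group Hs"

definition vector_walls :: "'a::euclidean_space set set \<Rightarrow> 'a set set" where
  "vector_walls Hs = (\<lambda>H. {x - y | x y. x \<in> H \<and> y \<in> H}) ` Hs"

text \<open>Finiteness of the vector group follows from the other conditions (it is the
  classical finiteness of the linear part of an affine reflection group); it is recorded as part of
  the notion. The group is not required to be irreducible or essential.\<close>

definition affine_wall_system :: "'a::euclidean_space set set \<Rightarrow> bool" where
  "affine_wall_system Hs \<longleftrightarrow>
     (\<forall>H\<in>Hs. \<exists>n c. n \<noteq> 0 \<and> H = {x. n \<bullet> x = c}) \<and>
     (\<forall>x. \<exists>r>0. finite {H\<in>Hs. H \<inter> ball x r \<noteq> {}}) \<and>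
     (\<forall>w\<in>wall_group Hs. \<forall>H\<in>Hs. w ` H \<in> Hs) \<and>
     finite (vector_wall_group Hs)"

text \<open>Two points lie in the same facet iff every hyperplane contains both of them or leaves
  both strictly on the same side.\<close>

definition same_facet :: "'a::euclidean_space set set \<Rightarrow> 'a \<Rightarrow> 'a \<Rightarrow> bool" where
  "same_facet Hs x y \<longleftrightarrow> (\<forall>H\<in>Hs. (x \<in> H \<and> y \<in> H) \<or> closed_segment x y \<inter> H = {})"

definition facets :: "'a::euclidean_space set set \<Rightarrow> 'a set set" where
  "facets Hs = {{y. same_facet Hs x y} | x. True}"

definition weyl_chambers :: "'a::euclidean_space set set \<Rightarrow> 'a set set" where
  "weyl_chambers Hs = {C \<in> facets (vector_walls Hs). open C}"

definition half_spaces :: "'a::euclidean_space set set \<Rightarrow> 'a set set" where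
  "half_spaces Hs = {{x. n \<bullet> x \<le> c} | n c. n \<noteq> 0 \<and> {x. n \<bullet> x = c} \<in> Hs}"


section \<open>Affine buildings\<close>

text \<open>The apartments are given by charts. A chart is an isomorphism from the model apartment
  onto an apartment (its range), and the type-preserving isomorphisms from the apartment
  \<open>range g\<close> to the apartment \<open>range h\<close> are the maps \<open>k \<circ> g\<inverse>\<close>, where \<open>k\<close> is a chart with
  \<open>range k = range h\<close>. So ``an isomorphism \<open>\<phi>\<close> from \<open>range g\<close> to some apartment, fixing \<open>g ` S\<close>
  pointwise'' is the same thing as a chart \<open>k\<close> that agrees with \<open>g\<close> on \<open>S\<close>, and then
  \<open>\<phi> ` g ` T = k ` T\<close>.\<close>

record ('p, 'a) building =
  points :: "'p set"
  bdist :: "'p \<Rightarrow> 'p \<Rightarrow> real"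
  walls :: "'a set set"
  charts :: "('a \<Rightarrow> 'p) set"

definition building_facets :: "'a::euclidean_space set set \<Rightarrow> ('a \<Rightarrow> 'p) set \<Rightarrow> 'p set set" where
  "building_facets Hs Ch = {g ` \<phi> | g \<phi>. g \<in> Ch \<and> \<phi> \<in> facets Hs}"

text \<open>The conditions say in turn: the charts of one apartment form one orbit of the wall group;
  charts are isometries onto their images; the apartments cover the space; the facets of the
  various apartments fit together to a partition of the space; and the two building axioms: any
  two facets lie in a common apartment, and for two apartments containing two given facets there is
  an isomorphism between them fixing both facets pointwise.\<close>

definition apartment_system ::
  "'p set \<Rightarrow> ('p \<Rightarrow> 'p \<Rightarrow> real) \<Rightarrow> 'a::euclidean_space set set \<Rightarrow> ('a \<Rightarrow> 'p) set \<Rightarrow> bool" where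
  "apartment_system P d Hs Ch \<longleftrightarrow>
     Ch \<noteq> {} \<and>
     (\<forall>g\<in>Ch. \<forall>w\<in>wall_group Hs. g \<circ> w \<in> Ch) \<and>
     (\<forall>g\<in>Ch. \<forall>h\<in>Ch. range g = range h \<longrightarrow> (\<exists>w\<in>wall_group Hs. h = g \<circ> w)) \<and>
     (\<forall>g\<in>Ch. \<forall>x y. d (g x) (g y) = dist x y) \<and>
     (\<Union>g\<in>Ch. range g) = P \<and>
     partition_on P (building_facets Hs Ch) \<and>
     (\<forall>\<phi>\<in>building_facets Hs Ch. \<forall>\<psi>\<in>building_facets Hs Ch. \<exists>g\<in>Ch. \<phi> \<union> \<psi> \<subseteq> range g) \<and>
     (\<forall>\<phi>\<in>building_facets Hs Ch. \<forall>\<psi>\<in>building_facets Hs Ch. \<forall>g\<in>Ch. \<forall>h\<in>Ch.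
        \<phi> \<union> \<psi> \<subseteq> range g \<inter> range h \<longrightarrow>
        (\<exists>k\<in>Ch. range k = range h \<and> (\<forall>x. g x \<in> \<phi> \<union> \<psi> \<longrightarrow> k x = g x)))"

text \<open>The last clause says that the apartment system is the complete (maximal) one.\<close>

definition affine_building :: "('p, 'a::euclidean_space) building \<Rightarrow> bool" where
  "affine_building X \<longleftrightarrow>
     Metric_space (points X) (bdist X) \<and>
     Metric_space.mcomplete (points X) (bdist X) \<and>
     affine_wall_system (walls X) \<and>
     apartment_system (points X) (bdist X) (walls X) (charts X) \<and>
     (\<forall>Ch. apartment_system (points X) (bdist X) (walls X) Ch \<and> charts X \<subseteq> Ch \<longrightarrow> Ch = charts X)"

abbreviation building_topology :: "('p, 'a::euclidean_space) building \<Rightarrow> 'p topology" where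
  "building_topology X \<equiv> Metric_space.mtopology (points X) (bdist X)"


section \<open>Cones in apartments\<close>

definition is_face :: "'a::euclidean_space set \<Rightarrow> 'a set \<Rightarrow> bool" where
  "is_face f g \<longleftrightarrow> f \<subseteq> closure g - g"

definition cone_family :: "'a::euclidean_space set set \<Rightarrow> 'a set set \<Rightarrow> bool" where
  "cone_family Hs \<F> \<longleftrightarrow>
     partition_on UNIV \<F> \<and>
     finite \<F> \<and>
     {0} \<in> \<F> \<and>
     (\<forall>f\<in>\<F>. \<exists>E P. finite E \<and> finite P \<and>
        f = {x. (\<forall>a\<in>E. a \<bullet> x = 0) \<and> (\<forall>a\<in>P. a \<bullet> x > 0)}) \<and>
     (\<forall>f\<in>\<F>. \<exists>\<G>\<subseteq>\<F>. closure f - f = \<Union>\<G>) \<and>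
     (\<forall>f\<in>\<F>. \<forall>g\<in>\<F>. is_face f g \<longrightarrow> closure f = span f \<inter> closure g) \<and>
     (\<forall>w\<in>vector_wall_group Hs. \<forall>f\<in>\<F>. w ` f \<in> \<F>)"

definition stable_nhds :: "'a::euclidean_space set set \<Rightarrow> 'a set set" where
  "stable_nhds Hs = {U. 0 \<in> interior U \<and> (\<forall>w\<in>vector_wall_group Hs. w ` U = U)}"

definition heart :: "'a::euclidean_space set set \<Rightarrow> 'a set \<Rightarrow> 'a set" where
  "heart Hs f = {x\<in>f. \<forall>w\<in>vector_wall_group Hs. w ` f = f \<longrightarrow> w x = x}"

definition heart_star :: "'a::euclidean_space set set \<Rightarrow> 'a \<Rightarrow> 'a set \<Rightarrow> 'a set" where
  "heart_star Hs s f =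
     (+) s ` (\<Union>C\<in>{C\<in>weyl_chambers Hs. heart Hs f \<subseteq> closure C}. closure C)"

text \<open>The base of the heart of \<open>s + f\<close>, in the coordinates of a chart.\<close>

definition heart_base :: "'a::euclidean_space set set \<Rightarrow> 'a \<Rightarrow> 'a set \<Rightarrow> 'a set" where
  "heart_base Hs s f =
     (+) s ` heart Hs f \<inter>
     \<Inter>{D\<in>half_spaces Hs. \<exists>r>0. ball s r \<inter> (+) s ` heart Hs f \<subseteq> D}"


section \<open>Cones in the building\<close>

text \<open>A cone of the apartment \<open>range g\<close> is \<open>g ` (s + f)\<close> with \<open>f\<close> in the given family; it is
  handled through the triple \<open>g, s, f\<close>. Whenever a construction involves choices on which the
  result does not depend (of an apartment, of an isomorphism \<open>\<phi>\<^sub>B\<close>, of a cone of an apartment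
  defining a given cone of the building), all choices are admitted, through a union or an
  existential quantifier.\<close>

definition extended_cone ::
  "('p, 'a::euclidean_space) building \<Rightarrow> ('a \<Rightarrow> 'p) \<Rightarrow> 'a \<Rightarrow> 'a set \<Rightarrow> 'p set" where
  "extended_cone X g s f =
     (\<Union>k\<in>{k\<in>charts X. \<forall>x\<in>(+) s ` heart (walls X) f. k x = g x}. k ` (+) s ` f)"

definition represents ::
  "('p, 'a::euclidean_space) building \<Rightarrow> 'a set set \<Rightarrow> ('a \<Rightarrow> 'p) \<Rightarrow> 'a \<Rightarrow> 'a set \<Rightarrow> 'p set \<Rightarrow> bool"
  where "represents X \<F> g s f F \<longleftrightarrow> g \<in> charts X \<and> f \<in> \<F> \<and> F = extended_cone X g s f"

definition building_cones ::
  "('p, 'a::euclidean_space) building \<Rightarrow> 'a set set \<Rightarrow> 'p set set" where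
  "building_cones X \<F> = {F. \<exists>g s f. represents X \<F> g s f F}"

text \<open>Parallelism of the cones \<open>g ` (a + \<gamma>)\<close> and \<open>h ` (b + \<eta>)\<close>: parallel subcones
  \<open>g ` (a' + \<gamma>)\<close> and \<open>h ` (b' + \<eta>)\<close> lie in a common apartment \<open>range k\<close>, and are translates of
  each other in the coordinates of \<open>k\<close>.\<close>

definition parallel_in_building :: "('p, 'a::euclidean_space) building \<Rightarrow>
    ('a \<Rightarrow> 'p) \<Rightarrow> 'a \<Rightarrow> 'a set \<Rightarrow> ('a \<Rightarrow> 'p) \<Rightarrow> 'a \<Rightarrow> 'a set \<Rightarrow> bool" where
  "parallel_in_building X g a \<gamma> h b \<eta> \<longleftrightarrow>
     (\<exists>a' b' v. \<exists>k\<in>charts X.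
        (+) a' ` \<gamma> \<subseteq> (+) a ` \<gamma> \<and> (+) b' ` \<eta> \<subseteq> (+) b ` \<eta> \<and>
        g ` (+) a' ` \<gamma> \<subseteq> range k \<and> h ` (+) b' ` \<eta> \<subseteq> range k \<and>
        k -` (h ` (+) b' ` \<eta>) = (+) v ` (k -` (g ` (+) a' ` \<gamma>)))"

definition parallel_cones ::
  "('p, 'a::euclidean_space) building \<Rightarrow> 'a set set \<Rightarrow> 'p set \<Rightarrow> 'p set \<Rightarrow> bool" where
  "parallel_cones X \<F> F G \<longleftrightarrow>
     (\<exists>g s f h t e. represents X \<F> g s f F \<and> represents X \<F> h t e G \<and>
        parallel_in_building X g s (heart (walls X) f) h t (heart (walls X) e))"

definition parallel_subcone ::
  "('p, 'a::euclidean_space) building \<Rightarrow> 'a set set \<Rightarrow> 'p set \<Rightarrow> 'p set \<Rightarrow> bool" where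
  "parallel_subcone X \<F> F G \<longleftrightarrow> F \<subseteq> G \<and> parallel_cones X \<F> F G"

definition cone_rel ::
  "('p, 'a::euclidean_space) building \<Rightarrow> 'a set set \<Rightarrow> ('p set \<times> 'p set) set" where
  "cone_rel X \<F> = {(F, G). F \<in> building_cones X \<F> \<and> G \<in> building_cones X \<F> \<and>
     (\<exists>H\<in>building_cones X \<F>. parallel_subcone X \<F> H F \<and> parallel_subcone X \<F> H G)}"

definition compactified ::
  "('p, 'a::euclidean_space) building \<Rightarrow> 'a set set \<Rightarrow> 'p set set set" where
  "compactified X \<F> = building_cones X \<F> // cone_rel X \<F>"

definition canonical_injection ::
  "('p, 'a::euclidean_space) building \<Rightarrow> 'a set set \<Rightarrow> 'p \<Rightarrow> 'p set set" where
  "canonical_injection X \<F> x = cone_rel X \<F> `` {{x}}"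


section \<open>The topology\<close>

text \<open>Here \<open>g -` F\<close> is the intersection of \<open>F\<close> with the apartment \<open>range g\<close>, in the coordinates
  of \<open>g\<close>.\<close>

definition cone_thickening ::
  "('p, 'a::euclidean_space) building \<Rightarrow> 'a set set \<Rightarrow> 'p set \<Rightarrow> 'a set \<Rightarrow> 'p set" where
  "cone_thickening X \<F> F U =
     \<Union>{k ` ({x + u | x u. x \<in> g -` F \<and> u \<in> U} \<inter> heart_star (walls X) s f) | g s f k.
        represents X \<F> g s f F \<and> k \<in> charts X \<and> (\<forall>x\<in>heart_base (walls X) s f. k x = g x)}"

definition basic_nhd ::
  "('p, 'a::euclidean_space) building \<Rightarrow> 'a set set \<Rightarrow> 'p set \<Rightarrow> 'a set \<Rightarrow> 'p set set set" where
  "basic_nhd X \<F> F U = {x\<in>compactified X \<F>. \<exists>G\<in>x. G \<subseteq> cone_thickening X \<F> F U}"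

definition cone_topology ::
  "('p, 'a::euclidean_space) building \<Rightarrow> 'a set set \<Rightarrow> 'p set set topology \<Rightarrow> bool" where
  "cone_topology X \<F> T \<longleftrightarrow>
     topspace T = compactified X \<F> \<and>
     (\<forall>x\<in>compactified X \<F>.
        (\<forall>F\<in>x. \<forall>U\<in>stable_nhds (walls X). \<exists>S. openin T S \<and> x \<in> S \<and> S \<subseteq> basic_nhd X \<F> F U) \<and>
        (\<forall>S. openin T S \<and> x \<in> S \<longrightarrow>
           (\<exists>F\<in>x. \<exists>U\<in>stable_nhds (walls X). basic_nhd X \<F> F U \<subseteq> S)))"

lemma cone_topology_unique:
  assumes "cone_topology X \<F> T" and "cone_topology X \<F> T'"
  shows "T = T'"
proof -
  have "openin T' S" if T: "cone_topology X \<F> T" and T': "cone_topology X \<F> T'"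
    and S: "openin T S" for T T' S
  proof (subst openin_subopen, intro ballI)
    fix x assume x: "x \<in> S"
    have "x \<in> compactified X \<F>"
      using x openin_subset[OF S] T unfolding cone_topology_def by auto
    then obtain F U where FU: "F \<in> x" "U \<in> stable_nhds (walls X)" "basic_nhd X \<F> F U \<subseteq> S"
      and "\<exists>R. openin T' R \<and> x \<in> R \<and> R \<subseteq> basic_nhd X \<F> F U"
      using T T' S x unfolding cone_topology_def by meson
    then show "\<exists>R. openin T' R \<and> x \<in> R \<and> R \<subseteq> S"
      by blast
  qed
  then show ?thesis
    using assms by (metis topology_eq)
qed

end

theory Submission
  imports Defs
begin

text \<open>
  The point \<open>p\<close> of the building is sent to the class of the cone \<open>{p}\<close>, and the whole theorem rests
  on the fact that this class contains nothing else: \<open>\<iota> p = {{p}}\<close>. A parallel subcone of \<open>{p}\<close> is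
  nonempty, hence equal to \<open>{p}\<close>; and if \<open>{p}\<close> is a parallel subcone of \<open>G\<close>, then the heart of
  \<open>G\<close> is a translate of a point. Hearts are stable under positive dilations, so the direction of
  \<open>G\<close> has \<open>0\<close> in it and is \<open>{0}\<close>, which makes \<open>G\<close> a point containing \<open>p\<close>
  (\<open>parallel_to_point_is_point\<close>, \<open>cone_rel_point_iff\<close>). Injectivity and the formula
  \<open>\<iota>\<inverse>(\<V>(F, U)) = F + U\<close> are then immediate, the only candidate for a representative of \<open>\<iota> p\<close>
  contained in the thickening being \<open>{p}\<close> itself.

  The other claims follow from two computations with thickenings. For a point, the base of the heart
  is the point and the closed Weyl chambers cover the model apartment, so the thickening of \<open>{p}\<close>
  by \<open>U\<close> is the union of the \<open>k ` (s + U)\<close> over all charts \<open>k\<close> with \<open>k s = p\<close>. Since charts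
  are isometries and any two points lie in a common apartment, for a ball \<open>U\<close> this is the metric
  ball around \<open>p\<close> (\<open>cone_thickening_point_ball\<close>), and balls are stable because the vectorial Weyl
  group acts by isometries. Hence every neighbourhood of \<open>\<iota> p\<close> pulls back to a set containing a
  metric ball, which is continuity. Conversely a cone contained in a metric ball is bounded and hence
  a point, so the basic neighbourhood of \<open>{p}\<close> given by a ball consists of images of points of that
  ball, which is openness (\<open>basic_nhd_point_ball_subset\<close>).

  Density means that no thickening is empty. The thickening of \<open>F\<close> contains the part of a cone
  \<open>s + f\<close> that lies in the star of its heart. Two points of the heart of \<open>f\<close> cannot be separated by
  a wall: the reflection in it would fix a point of \<open>f\<close>, hence stabilize \<open>f\<close>, hence fix the heart.
  So the heart lies in one Weyl facet and therefore in one closed Weyl chamber, so its translate by \<open>s\<close>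
  is part of the star (\<open>heart_within_facet\<close>, \<open>cone_meets_heart_star\<close>).
\<close>

section \<open>The vectorial Weyl group and the Weyl chambers\<close>

lemma hyperplane_reflection_linear_part:
  "hyperplane_reflection n c v - hyperplane_reflection n c 0 = v - (2 * (n \<bullet> v) / (n \<bullet> n)) *\<^sub>R n"
  by (simp add: hyperplane_reflection_def algebra_simps diff_divide_distrib flip: scaleR_left_distrib)

lemma orthogonal_transformation_reflection:
  fixes n :: "'a::euclidean_space"
  assumes "n \<noteq> 0"
  shows "orthogonal_transformation (\<lambda>v. v - (2 * (n \<bullet> v) / (n \<bullet> n)) *\<^sub>R n)"
  unfolding orthogonal_transformation_def
proof (intro conjI allI)
  show "linear (\<lambda>v. v - (2 * (n \<bullet> v) / (n \<bullet> n)) *\<^sub>R n)"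
    by (rule linearI) (simp_all add: inner_add_right algebra_simps add_divide_distrib)
  show "(v - (2 * (n \<bullet> v) / (n \<bullet> n)) *\<^sub>R n) \<bullet> (w - (2 * (n \<bullet> w) / (n \<bullet> n)) *\<^sub>R n) = v \<bullet> w" for v w
    using assms by (simp add: inner_diff_left inner_diff_right inner_commute field_simps)
qed

lemma linear_part_orthogonal:
  assumes "w \<in> wall_group Hs"
  shows "orthogonal_transformation (\<lambda>v. w v - w 0)"
  using assms
proof induction
  case wall_group_id
  then show ?case by (simp add: orthogonal_transformation_id)
next
  case (wall_group_refl n c w)
  let ?r = "\<lambda>v. v - (2 * (n \<bullet> v) / (n \<bullet> n)) *\<^sub>R n"
  have "(hyperplane_reflection n c \<circ> w) v - (hyperplane_reflection n c \<circ> w) 0 = ?r (w v - w 0)" for v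
    by (simp add: hyperplane_reflection_def inner_diff_right algebra_simps diff_divide_distrib
        flip: scaleR_left_distrib)
  then show ?case
    using orthogonal_transformation_compose[OF orthogonal_transformation_reflection wall_group_refl.IH]
      wall_group_refl.hyps(1) by (simp add: o_def)
qed

lemma vector_wall_group_orthogonal:
  "w \<in> vector_wall_group Hs \<Longrightarrow> orthogonal_transformation w"
  using linear_part_orthogonal unfolding vector_wall_group_def by blast

lemma vector_wall_group_linear: "w \<in> vector_wall_group Hs \<Longrightarrow> linear w"
  using vector_wall_group_orthogonal by (rule orthogonal_transformation_linear)

lemma ball_in_stable_nhds:
  assumes "r > 0"
  shows "ball 0 r \<in> stable_nhds Hs"
proof -
  have "w ` ball 0 r = ball 0 r" if "w \<in> vector_wall_group Hs" for w
  proof -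
    have w: "orthogonal_transformation w" by (rule vector_wall_group_orthogonal[OF that])
    show ?thesis
      using image_orthogonal_transformation_ball[OF w, of 0 r]
        linear_0[OF vector_wall_group_linear[OF that]] by simp
  qed
  then show ?thesis using assms by (simp add: stable_nhds_def)
qed

lemma differences_in_hyperplane:
  fixes n :: "'a::euclidean_space"
  assumes "n \<noteq> 0"
  shows "{x - y | x y. n \<bullet> x = c \<and> n \<bullet> y = c} = {v. n \<bullet> v = 0}"
proof -
  define q where "q = (c / (n \<bullet> n)) *\<^sub>R n"
  have q: "n \<bullet> q = c" using assms by (simp add: q_def)
  have "v \<in> {x - y | x y. n \<bullet> x = c \<and> n \<bullet> y = c}" if "n \<bullet> v = 0" for v
  proof -
    have "v = (v + q) - q \<and> n \<bullet> (v + q) = c \<and> n \<bullet> q = c"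
      using that q by (simp add: inner_add_right)
    then show ?thesis by blast
  qed
  moreover have "n \<bullet> v = 0" if "v \<in> {x - y | x y. n \<bullet> x = c \<and> n \<bullet> y = c}" for v
    using that by (auto simp: inner_diff_right)
  ultimately show ?thesis by blast
qed

text \<open>A vectorial wall is recovered as the fixed point set of an element of the vectorial Weyl group;
  as that group is finite, so is the set of vectorial walls, although the set of walls need not be.\<close>

lemma vector_wall_reflection:
  assumes "affine_wall_system Hs" and "H \<in> vector_walls Hs"
  shows "\<exists>n. n \<noteq> 0 \<and> H = {v. n \<bullet> v = 0} \<and> (\<exists>r\<in>vector_wall_group Hs. \<forall>v. r v = v \<longleftrightarrow> v \<in> H)"
proof -
  obtain H0 where H0: "H0 \<in> Hs" "H = {x - y | x y. x \<in> H0 \<and> y \<in> H0}"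
    using assms(2) by (auto simp: vector_walls_def)
  obtain n c where n: "n \<noteq> 0" "H0 = {x. n \<bullet> x = c}"
    using assms(1) H0(1) unfolding affine_wall_system_def by blast
  have H: "H = {v. n \<bullet> v = 0}"
    unfolding H0(2) n(2) mem_Collect_eq by (rule differences_in_hyperplane[OF n(1)])
  let ?r = "\<lambda>v. v - (2 * (n \<bullet> v) / (n \<bullet> n)) *\<^sub>R n"
  have "hyperplane_reflection n c \<circ> id \<in> wall_group Hs"
    using wall_group_refl[OF n(1)] wall_group_id n(2) H0(1) by blast
  then have "?r \<in> vector_wall_group Hs"
    unfolding vector_wall_group_def image_iff
    by (rule bexI[rotated]) (simp add: fun_eq_iff hyperplane_reflection_linear_part)
  moreover have "?r v = v \<longleftrightarrow> v \<in> H" for v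
    using n(1) by (simp add: H)
  ultimately have "\<exists>r\<in>vector_wall_group Hs. \<forall>v. r v = v \<longleftrightarrow> v \<in> H"
    by (intro bexI[of _ ?r]) auto
  with n(1) H show ?thesis by (intro exI[of _ n]) auto
qed

lemma finite_vector_walls:
  assumes "affine_wall_system Hs"
  shows "finite (vector_walls Hs)"
proof (rule finite_subset)
  show "vector_walls Hs \<subseteq> (\<lambda>r. {v. r v = v}) ` vector_wall_group Hs"
  proof
    fix H assume "H \<in> vector_walls Hs"
    then obtain r where "r \<in> vector_wall_group Hs" "\<forall>v. r v = v \<longleftrightarrow> v \<in> H"
      using vector_wall_reflection[OF assms] by blast
    then show "H \<in> (\<lambda>r. {v. r v = v}) ` vector_wall_group Hs"
      by (intro image_eqI[of _ _ r]) auto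
  qed
  show "finite ((\<lambda>r. {v. r v = v}) ` vector_wall_group Hs)"
    using assms by (simp add: affine_wall_system_def)
qed

text \<open>Turns the coordinate-free definition of facets into sign conditions.\<close>

lemma segment_misses_linear_hyperplane_iff:
  fixes n :: "'a::euclidean_space"
  shows "closed_segment x y \<inter> {v. n \<bullet> v = 0} = {} \<longleftrightarrow> 0 < (n \<bullet> x) * (n \<bullet> y)"
proof -
  have "linear ((\<bullet>) n)"
    by (simp add: linearI inner_add_right)
  then have "(\<bullet>) n ` closed_segment x y = closed_segment (n \<bullet> x) (n \<bullet> y)"
    by (simp add: closed_segment_linear_image)
  moreover have "closed_segment x y \<inter> {v. n \<bullet> v = 0} = {} \<longleftrightarrow> 0 \<notin> (\<bullet>) n ` closed_segment x y"
    by auto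
  moreover have "0 \<notin> closed_segment a b \<longleftrightarrow> 0 < a * b" for a b :: real
    by (auto simp: closed_segment_eq_real_ivl zero_less_mult_iff)
  ultimately show ?thesis by simp
qed

text \<open>Choose a vector \<open>c\<close> on no wall. Moving from \<open>y \<in> S\<close> a short way in the direction \<open>c\<close> leaves all
  walls through \<open>y\<close>, to a side given by \<open>c\<close>, and crosses none of the others. The resulting signs
  depend only on the facet of \<open>y\<close>, so all points of \<open>S\<close> are moved into the same chamber. Singletons
  \<open>S\<close> are of interest too: the closed chambers cover the space.\<close>

lemma within_facet_imp_within_closed_chamber:
  fixes Hs :: "'a::euclidean_space set set"
  assumes sys: "affine_wall_system Hs"
    and S: "\<And>x y. \<lbrakk>x \<in> S; y \<in> S\<rbrakk> \<Longrightarrow> same_facet (vector_walls Hs) x y" "S \<noteq> {}"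
  shows "\<exists>C\<in>weyl_chambers Hs. S \<subseteq> closure C"
proof -
  let ?V = "vector_walls Hs"
  have fin: "finite ?V" using finite_vector_walls[OF sys] .
  obtain n where n: "\<And>H. H \<in> ?V \<Longrightarrow> n H \<noteq> 0" "\<And>H. H \<in> ?V \<Longrightarrow> H = {v. n H \<bullet> v = 0}"
    using vector_wall_reflection[OF sys] by metis
  have "negligible (\<Union>?V)"
    using fin n by (intro negligible_Union) (metis negligible_hyperplane)+
  then obtain c where "c \<notin> \<Union>?V"
    using non_negligible_UNIV by (metis UNIV_eq_I)
  then have c: "n H \<bullet> c \<noteq> 0" if "H \<in> ?V" for H
    using n(2)[OF that] that by blast
  have facet: "same_facet ?V x y \<longleftrightarrow>
      (\<forall>H\<in>?V. n H \<bullet> x = 0 \<and> n H \<bullet> y = 0 \<or> 0 < (n H \<bullet> x) * (n H \<bullet> y))" for x y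
    unfolding same_facet_def
    using n(2) segment_misses_linear_hyperplane_iff[of x y "n _"] by (smt (verit) mem_Collect_eq)
  \<comment> \<open>A number with the sign that \<open>n H \<bullet> (y + t *\<^sub>R c)\<close> has for all small positive \<open>t\<close>.\<close>
  define m where "m y H = (if n H \<bullet> y = 0 then n H \<bullet> c else n H \<bullet> y)" for y H
  have m: "\<forall>\<^sub>F t in at_right 0. \<forall>H\<in>?V. 0 < m y H * (n H \<bullet> (y + t *\<^sub>R c))" for y
  proof (intro eventually_ball_finite[OF fin] ballI)
    fix H assume H: "H \<in> ?V"
    show "\<forall>\<^sub>F t in at_right 0. 0 < m y H * (n H \<bullet> (y + t *\<^sub>R c))"
    proof (cases "n H \<bullet> y = 0")
      case True
      have "\<forall>\<^sub>F t in at_right (0::real). 0 < t"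
        by (simp add: eventually_at_right_less)
      then show ?thesis
      proof eventually_elim
        case (elim t)
        have "0 < t * ((n H \<bullet> c) * (n H \<bullet> c))"
          using elim c[OF H] by (metis mult_pos_pos not_real_square_gt_zero)
        then show ?case using True by (simp add: m_def inner_add_right mult_ac)
      qed
    next
      case False
      have "((\<lambda>t. m y H * (n H \<bullet> (y + t *\<^sub>R c))) \<longlongrightarrow> m y H * (n H \<bullet> (y + 0 *\<^sub>R c))) (at_right 0)"
        by (intro tendsto_intros)
      moreover have "0 < m y H * (n H \<bullet> (y + 0 *\<^sub>R c))"
        using False by (auto simp: m_def zero_less_mult_iff linorder_neq_iff)
      ultimately show ?thesis by (rule order_tendstoD(1))
    qed
  qed
  obtain x where x: "x \<in> S" using S(2) by blast
  obtain e where "\<forall>H\<in>?V. 0 < m x H * (n H \<bullet> (x + e *\<^sub>R c))"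
    using eventually_happens'[OF _ m[of x]] by auto
  then obtain z where z: "\<forall>H\<in>?V. 0 < m x H * (n H \<bullet> z)" by blast
  define C where "C = {y. same_facet ?V z y}"
  have C: "C = (\<Inter>H\<in>?V. {y. 0 < m x H * (n H \<bullet> y)})"
    using z by (auto simp: C_def facet zero_less_mult_iff) force+
  have "open C"
    unfolding C using fin
    by (intro open_INT ballI open_Collect_less continuous_intros)
  then have "C \<in> weyl_chambers Hs"
    by (auto simp: weyl_chambers_def facets_def C_def)
  moreover have "y \<in> closure C" if y: "y \<in> S" for y
  proof -
    have same: "0 < m x H * m y H" if "H \<in> ?V" for H
      using S(1)[OF x y] that c[OF that] unfolding facet m_def
      by (auto simp: zero_less_mult_iff linorder_neq_iff)
    have "\<forall>\<^sub>F t in at_right 0. y + t *\<^sub>R c \<in> closure C"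
      using m[of y]
    proof eventually_elim
      case (elim t)
      have "0 < m x H * (n H \<bullet> (y + t *\<^sub>R c))" if "H \<in> ?V" for H
        using same[OF that] bspec[OF elim that] by (auto simp: zero_less_mult_iff)
      then have "y + t *\<^sub>R c \<in> C" unfolding C by blast
      then show ?case using closure_subset by blast
    qed
    moreover have "((\<lambda>t. y + t *\<^sub>R c) \<longlongrightarrow> y + 0 *\<^sub>R c) (at_right 0)"
      by (intro tendsto_intros)
    ultimately show ?thesis
      using Lim_in_closed_set[of "closure C" _ "at_right (0::real)" "y + 0 *\<^sub>R c"] by simp
  qed
  ultimately show ?thesis by blast
qed

lemma same_facet_refl: "same_facet Hs x x"
  by (auto simp: same_facet_def)

lemma zero_in_closed_chamber:
  assumes sys: "affine_wall_system Hs" and C: "C \<in> weyl_chambers Hs"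
  shows "0 \<in> closure C"
proof -
  obtain z where z: "C = {y. same_facet (vector_walls Hs) z y}"
    using C by (auto simp: weyl_chambers_def facets_def)
  have "same_facet (vector_walls Hs) z (t *\<^sub>R z)" if "0 < t" for t
    unfolding same_facet_def
  proof
    fix H assume "H \<in> vector_walls Hs"
    then obtain n where H: "H = {v. n \<bullet> v = 0}"
      using vector_wall_reflection[OF sys] by blast
    have "0 < (n \<bullet> z) * (n \<bullet> (t *\<^sub>R z))" if "n \<bullet> z \<noteq> 0"
      using that \<open>0 < t\<close> by (auto simp: zero_less_mult_iff mult_less_0_iff)
    then show "z \<in> H \<and> t *\<^sub>R z \<in> H \<or> closed_segment z (t *\<^sub>R z) \<inter> H = {}"
      unfolding H segment_misses_linear_hyperplane_iff by auto
  qed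
  then have "\<forall>\<^sub>F t in at_right 0. t *\<^sub>R z \<in> closure C"
    using closure_subset unfolding z
    by (intro eventually_mono[OF eventually_at_right_less[of 0]]) blast
  moreover have "((\<lambda>t. t *\<^sub>R z) \<longlongrightarrow> 0 *\<^sub>R z) (at_right 0)"
    by (intro tendsto_intros)
  ultimately show ?thesis
    using Lim_in_closed_set[of "closure C" _ "at_right (0::real)" "0 *\<^sub>R z"] by simp
qed


section \<open>Cones of the model apartment and their hearts\<close>

lemma cone_family_convex_scaling:
  assumes "cone_family Hs \<F>" and "f \<in> \<F>"
  shows "convex f" and "\<And>t x. \<lbrakk>0 < t; x \<in> f\<rbrakk> \<Longrightarrow> t *\<^sub>R x \<in> f"
proof -
  have "\<forall>f\<in>\<F>. \<exists>E P. finite E \<and> finite P \<and>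
      f = {x. (\<forall>a\<in>E. a \<bullet> x = 0) \<and> (\<forall>a\<in>P. a \<bullet> x > 0)}"
    using assms(1) by (simp add: cone_family_def)
  then obtain E P where f: "f = {x. (\<forall>a\<in>E. a \<bullet> x = 0) \<and> (\<forall>a\<in>P. a \<bullet> x > 0)}"
    using assms(2) by meson
  have "f = (\<Inter>a\<in>E. {x. a \<bullet> x = 0}) \<inter> (\<Inter>a\<in>P. {x. a \<bullet> x > 0})"
    using f by auto
  then show "convex f"
    by (simp add: convex_Int convex_INT convex_hyperplane convex_halfspace_gt)
  show "t *\<^sub>R x \<in> f" if "0 < t" "x \<in> f" for t x
    using that by (auto simp: f)
qed

lemma cone_family_eq_if_meet:
  assumes "cone_family Hs \<F>" "f \<in> \<F>" "g \<in> \<F>" "x \<in> f" "x \<in> g"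
  shows "f = g"
proof -
  have "partition_on UNIV \<F>" using assms(1) by (simp add: cone_family_def)
  then have "disjoint \<F>" by (simp add: partition_on_def)
  then show ?thesis using assms(2-5) disjointD by blast
qed

lemma cone_family_nonempty: "\<lbrakk>cone_family Hs \<F>; f \<in> \<F>\<rbrakk> \<Longrightarrow> f \<noteq> {}"
  by (auto simp: cone_family_def partition_on_def)

lemma zero_in_cone_family: "cone_family Hs \<F> \<Longrightarrow> {0} \<in> \<F>"
  by (simp add: cone_family_def)

text \<open>\<open>{0}\<close> is itself a member of the partition.\<close>

lemma cone_with_zero_trivial: "\<lbrakk>cone_family Hs \<F>; f \<in> \<F>; 0 \<in> f\<rbrakk> \<Longrightarrow> f = {0}"
  using cone_family_eq_if_meet zero_in_cone_family by blast

lemma bounded_cone_trivial: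
  assumes "cone_family Hs \<F>" "f \<in> \<F>" "bounded f"
  shows "f = {0}"
proof -
  obtain v where v: "v \<in> f" using cone_family_nonempty[OF assms(1,2)] by blast
  obtain B where B: "\<And>x. x \<in> f \<Longrightarrow> norm x \<le> B" using assms(3) bounded_iff by blast
  have "v = 0"
  proof (rule ccontr)
    assume "v \<noteq> 0"
    define t where "t = (\<bar>B\<bar> + 1) / norm v"
    have "0 < t" using \<open>v \<noteq> 0\<close> by (simp add: t_def add_nonneg_pos)
    then have "norm (t *\<^sub>R v) \<le> B"
      using B cone_family_convex_scaling(2)[OF assms(1,2)] v by blast
    then show False using \<open>v \<noteq> 0\<close> \<open>0 < t\<close> by (simp add: t_def)
  qed
  then show ?thesis using cone_with_zero_trivial[OF assms(1,2)] v by blast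
qed

lemma heart_scaling:
  assumes "cone_family Hs \<F>" "f \<in> \<F>" "x \<in> heart Hs f" "0 < t"
  shows "t *\<^sub>R x \<in> heart Hs f"
proof -
  have x: "x \<in> f" "\<And>w. \<lbrakk>w \<in> vector_wall_group Hs; w ` f = f\<rbrakk> \<Longrightarrow> w x = x"
    using assms(3) by (simp_all add: heart_def)
  have "w (t *\<^sub>R x) = t *\<^sub>R x" if "w \<in> vector_wall_group Hs" "w ` f = f" for w
    using linear_scale[OF vector_wall_group_linear[OF that(1)]] x(2)[OF that] by simp
  then show ?thesis
    using cone_family_convex_scaling(2)[OF assms(1,2,4) x(1)] by (simp add: heart_def)
qed

lemma heart_zero: "heart Hs {0} = {0}"
  using linear_0[OF vector_wall_group_linear] by (auto simp: heart_def)

text \<open>If the segment from \<open>x\<close> to \<open>y\<close> meets a wall in a point \<open>z\<close>, then \<open>z \<in> f\<close> by convexity, and the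
  reflection in the wall maps \<open>f\<close> to a member of the partition that also contains \<open>z\<close>. It therefore
  stabilizes \<open>f\<close> and fixes \<open>x\<close> and \<open>y\<close>, which thus lie on the wall.\<close>

lemma heart_within_facet:
  assumes sys: "affine_wall_system Hs" and cf: "cone_family Hs \<F>" and f: "f \<in> \<F>"
    and xy: "x \<in> heart Hs f" "y \<in> heart Hs f"
  shows "same_facet (vector_walls Hs) x y"
  unfolding same_facet_def
proof
  fix H assume "H \<in> vector_walls Hs"
  then obtain r where r: "r \<in> vector_wall_group Hs" "\<And>v. r v = v \<longleftrightarrow> v \<in> H"
    using vector_wall_reflection[OF sys] by blast
  have "x \<in> H \<and> y \<in> H" if "z \<in> closed_segment x y" "z \<in> H" for z
  proof -
    have "z \<in> f"
      using that(1) xy closed_segment_subset[OF _ _ cone_family_convex_scaling(1)[OF cf f]]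
      by (auto simp: heart_def)
    then have "z \<in> r ` f" using r(2) that(2) by (metis imageI)
    moreover have "r ` f \<in> \<F>" using cf f r(1) by (simp add: cone_family_def)
    ultimately have "r ` f = f" using cone_family_eq_if_meet[OF cf _ f _ \<open>z \<in> f\<close>] by blast
    then have "r x = x" "r y = y" using xy r(1) by (simp_all add: heart_def)
    then show ?thesis by (simp_all add: r(2))
  qed
  then show "x \<in> H \<and> y \<in> H \<or> closed_segment x y \<inter> H = {}" by blast
qed

lemma cone_meets_heart_star:
  assumes sys: "affine_wall_system Hs" and cf: "cone_family Hs \<F>" and f: "f \<in> \<F>"
  shows "(+) s ` f \<inter> heart_star Hs s f \<noteq> {}"
proof -
  \<comment> \<open>The auxiliary set \<open>S\<close> is the heart, or a single point of \<open>f\<close> should the heart be empty.\<close>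
  obtain S x where "x \<in> f" "x \<in> S" "heart Hs f \<subseteq> S"
    and S: "\<And>x y. \<lbrakk>x \<in> S; y \<in> S\<rbrakk> \<Longrightarrow> same_facet (vector_walls Hs) x y"
  proof (cases "heart Hs f = {}")
    case True
    obtain x where "x \<in> f" using cone_family_nonempty[OF cf f] by blast
    then show ?thesis using that[of x "{x}"] same_facet_refl True by blast
  next
    case False
    then obtain x where "x \<in> heart Hs f" by blast
    then show ?thesis using that[of x "heart Hs f"] heart_within_facet[OF sys cf f]
      by (auto simp: heart_def)
  qed
  then obtain C where "C \<in> weyl_chambers Hs" "S \<subseteq> closure C"
    using within_facet_imp_within_closed_chamber[OF sys S] by blast
  then have "s + x \<in> (+) s ` f \<inter> heart_star Hs s f"
    using \<open>x \<in> f\<close> \<open>x \<in> S\<close> \<open>heart Hs f \<subseteq> S\<close> unfolding heart_star_def by blast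
  then show ?thesis by blast
qed

lemma heart_star_zero:
  assumes "affine_wall_system Hs"
  shows "heart_star Hs s {0} = UNIV"
proof -
  have "\<exists>C\<in>weyl_chambers Hs. 0 \<in> closure C \<and> x \<in> closure C" for x
    using within_facet_imp_within_closed_chamber[OF assms, of "{x}"] same_facet_refl
      zero_in_closed_chamber[OF assms] by blast
  then have "(\<Union>C\<in>{C\<in>weyl_chambers Hs. heart Hs {0} \<subseteq> closure C}. closure C) = UNIV"
    unfolding heart_zero by blast
  then show ?thesis by (simp add: heart_star_def)
qed

section \<open>Charts and points of the building\<close>

lemma affine_building_wall_system: "affine_building X \<Longrightarrow> affine_wall_system (walls X)"
  unfolding affine_building_def by (elim conjE)

lemma affine_building_metric: "affine_building X \<Longrightarrow> Metric_space (points X) (bdist X)"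
  unfolding affine_building_def by (elim conjE)

lemma affine_building_apartments:
  assumes "affine_building X"
  shows "\<forall>g\<in>charts X. \<forall>x y. bdist X (g x) (g y) = dist x y"
    and "(\<Union>g\<in>charts X. range g) = points X"
    and "partition_on (points X) (building_facets (walls X) (charts X))"
    and "\<forall>\<phi>\<in>building_facets (walls X) (charts X). \<forall>\<psi>\<in>building_facets (walls X) (charts X).
      \<exists>g\<in>charts X. \<phi> \<union> \<psi> \<subseteq> range g"
proof -
  have "apartment_system (points X) (bdist X) (walls X) (charts X)"
    using assms unfolding affine_building_def by (elim conjE)
  then show "\<forall>g\<in>charts X. \<forall>x y. bdist X (g x) (g y) = dist x y"
    and "(\<Union>g\<in>charts X. range g) = points X"
    and "partition_on (points X) (building_facets (walls X) (charts X))"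
    and "\<forall>\<phi>\<in>building_facets (walls X) (charts X). \<forall>\<psi>\<in>building_facets (walls X) (charts X).
      \<exists>g\<in>charts X. \<phi> \<union> \<psi> \<subseteq> range g"
    unfolding apartment_system_def by - (elim conjE, assumption)+
qed

lemma chart_dist:
  "\<lbrakk>affine_building X; g \<in> charts X\<rbrakk> \<Longrightarrow> bdist X (g x) (g y) = dist x y"
  by (rule affine_building_apartments(1)[rule_format])

lemma chart_in_points:
  "\<lbrakk>affine_building X; g \<in> charts X\<rbrakk> \<Longrightarrow> g x \<in> points X"
  unfolding affine_building_apartments(2)[symmetric] by (rule UN_I[of g]) auto

lemma chart_inj:
  assumes "affine_building X" "g \<in> charts X"
  shows "inj g"
proof (rule injI)
  fix x y assume "g x = g y"
  then have "dist x y = dist y y"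
    using chart_dist[OF assms] by metis
  then show "x = y" by simp
qed

text \<open>Every point lies in a facet, and any two facets have a common apartment.\<close>

lemma ex_chart_through_two_points:
  assumes "affine_building X" "p \<in> points X" "q \<in> points X"
  shows "\<exists>g\<in>charts X. \<exists>s t. g s = p \<and> g t = q"
proof -
  let ?B = "building_facets (walls X) (charts X)"
  note ax = affine_building_apartments(4)[OF assms(1)]
  have "\<Union>?B = points X"
    using affine_building_apartments(3)[OF assms(1)] by (simp add: partition_on_def)
  then obtain \<phi> \<psi> where "\<phi> \<in> ?B" "\<psi> \<in> ?B" "p \<in> \<phi>" "q \<in> \<psi>"
    using assms(2,3) by (metis UnionE)
  then obtain g where "g \<in> charts X" and sub: "\<phi> \<union> \<psi> \<subseteq> range g"
    using ax[rule_format] by metis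
  moreover have "p \<in> range g" "q \<in> range g"
    using sub \<open>p \<in> \<phi>\<close> \<open>q \<in> \<psi>\<close> by (simp_all add: subset_iff)
  then obtain s t where "g s = p" "g t = q" by (elim rangeE) simp
  ultimately show ?thesis by (intro bexI[of _ g] exI[of _ s] exI[of _ t] conjI)
qed

lemma ex_chart_through_point:
  "\<lbrakk>affine_building X; p \<in> points X\<rbrakk> \<Longrightarrow> \<exists>g\<in>charts X. \<exists>s. g s = p"
  using ex_chart_through_two_points[of X p p] by auto

section \<open>Point cones\<close>

lemma chart_image_subset_extended_cone:
  "g \<in> charts X \<Longrightarrow> g ` (+) s ` f \<subseteq> extended_cone X g s f"
  unfolding extended_cone_def by blast

lemma represents_image_subset: "represents X \<F> g s f F \<Longrightarrow> g ` (+) s ` f \<subseteq> F"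
  using chart_image_subset_extended_cone unfolding represents_def by metis

lemma extended_cone_zero: "g \<in> charts X \<Longrightarrow> extended_cone X g s {0} = {g s}"
  by (auto simp: extended_cone_def heart_zero)

lemma represents_zero:
  "\<lbrakk>cone_family (walls X) \<F>; g \<in> charts X\<rbrakk> \<Longrightarrow> represents X \<F> g s {0} {g s}"
  by (simp add: represents_def extended_cone_zero zero_in_cone_family)

lemma building_cone_nonempty:
  assumes "cone_family (walls X) \<F>" "F \<in> building_cones X \<F>"
  shows "F \<noteq> {}"
  using assms represents_image_subset cone_family_nonempty
  unfolding building_cones_def represents_def by fastforce

text \<open>A representative \<open>g ` (s + f)\<close> is an isometric copy of a cone inside \<open>F\<close>, and the only bounded
  cone is \<open>{0}\<close>.\<close>

lemma building_cone_in_ball_is_point: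
  assumes X: "affine_building X" and cf: "cone_family (walls X) \<F>"
    and F: "represents X \<F> g s f F" and "p \<in> points X"
    and small: "\<And>q. q \<in> F \<Longrightarrow> bdist X p q \<le> r"
  shows "f = {0}" and "F = {g s}"
proof -
  have g: "g \<in> charts X" and f: "f \<in> \<F>" using F by (auto simp: represents_def)
  interpret Metric_space "points X" "bdist X"
    using X by (rule affine_building_metric)
  have "dist x y \<le> 2 * r" if "x \<in> f" "y \<in> f" for x y
  proof -
    have "g (s + x) \<in> F" "g (s + y) \<in> F"
      using represents_image_subset[OF F] that by auto
    then have "bdist X (g (s + x)) p + bdist X p (g (s + y)) \<le> 2 * r"
      using small commute by (smt (verit))
    moreover have "bdist X (g (s + x)) (g (s + y)) \<le> bdist X (g (s + x)) p + bdist X p (g (s + y))"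
      using triangle chart_in_points[OF X g] \<open>p \<in> points X\<close> by blast
    ultimately show ?thesis using chart_dist[OF X g, of "s + x" "s + y"] by simp
  qed
  then have "bounded f"
    by (metis bounded_two_points)
  then show "f = {0}" using bounded_cone_trivial[OF cf f] by blast
  then show "F = {g s}" using F g by (simp add: represents_def extended_cone_zero)
qed

lemma represents_singleton:
  assumes X: "affine_building X" and cf: "cone_family (walls X) \<F>" and F: "represents X \<F> g s f {p}"
  shows "f = {0}" and "p = g s"
proof -
  have g: "g \<in> charts X" and f: "f \<in> \<F>" using F by (auto simp: represents_def)
  obtain x where "x \<in> f" using cone_family_nonempty[OF cf f] by blast
  then have "g (s + x) = p" using represents_image_subset[OF F] by auto
  then have p: "p \<in> points X" using chart_in_points[OF X g] by metis
  interpret Metric_space "points X" "bdist X"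
    using X by (rule affine_building_metric)
  have "f = {0} \<and> {p} = {g s}"
    using building_cone_in_ball_is_point[OF X cf F p, of 0] p by simp
  then show "f = {0}" and "p = g s" by auto
qed

text \<open>In the coordinates of a common apartment, the heart of \<open>G\<close> is a translate of a point, hence
  itself a point. For \<open>u\<close> in the heart, \<open>2 u\<close> is in it as well, so \<open>u = 0\<close>; this puts \<open>0\<close> into
  the direction of \<open>G\<close>.\<close>

lemma parallel_to_point_is_point:
  assumes X: "affine_building X" and cf: "cone_family (walls X) \<F>" and G: "parallel_cones X \<F> {p} G"
  shows "is_singleton G"
proof -
  obtain g s f h t e where rep: "represents X \<F> g s f {p}" "represents X \<F> h t e G"
    and par: "parallel_in_building X g s (heart (walls X) f) h t (heart (walls X) e)"
    using G unfolding parallel_cones_def by blast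
  have h: "h \<in> charts X" and e: "e \<in> \<F>" using rep by (auto simp: represents_def)
  have f: "f = {0}" using represents_singleton[OF X cf rep(1)] by blast
  let ?E = "heart (walls X) e"
  obtain a' b' v k where k: "k \<in> charts X" "g ` (+) a' ` {0} \<subseteq> range k" "h ` (+) b' ` ?E \<subseteq> range k"
    and eq: "k -` (h ` (+) b' ` ?E) = (+) v ` (k -` (g ` (+) a' ` {0}))"
    using par unfolding parallel_in_building_def f heart_zero by (elim exE bexE conjE)
  obtain x where "g a' = k x" using k(2) by auto
  then have "k -` (g ` (+) a' ` {0}) = k -` (k ` {x})" by simp
  also have "\<dots> = {x}" by (rule inj_vimage_image_eq[OF chart_inj[OF X k(1)]])
  finally have "k ` (k -` (h ` (+) b' ` ?E)) = {k (v + x)}" by (simp add: eq)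
  then have image: "h ` (+) b' ` ?E = {k (v + x)}"
    using k(3) by (simp add: image_vimage_eq Int_absorb2)
  then obtain u where u: "u \<in> ?E" by blast
  then have "2 *\<^sub>R u \<in> ?E" using heart_scaling[OF cf e] by simp
  have const: "h (b' + z) = k (v + x)" if "z \<in> ?E" for z
    using image that by (metis imageI singletonD)
  have "h (b' + u) = h (b' + 2 *\<^sub>R u)"
    using const[OF u] const[OF \<open>2 *\<^sub>R u \<in> ?E\<close>] by simp
  then have "b' + u = b' + 2 *\<^sub>R u" by (rule injD[OF chart_inj[OF X h]])
  then have "u = 0" by (simp add: scaleR_2)
  then have "0 \<in> e" using u by (simp add: heart_def)
  then have "e = {0}" using cone_with_zero_trivial[OF cf e] by blast
  then show ?thesis using rep(2) h by (simp add: represents_def extended_cone_zero)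
qed

lemma parallel_subcone_of_point_iff:
  assumes X: "affine_building X" and cf: "cone_family (walls X) \<F>" and p: "p \<in> points X"
  shows "parallel_subcone X \<F> {p} G \<longleftrightarrow> G = {p}"
proof
  assume "parallel_subcone X \<F> {p} G"
  then show "G = {p}"
    using parallel_to_point_is_point[OF X cf] unfolding parallel_subcone_def
    by (metis insert_subset is_singletonE singletonD)
next
  obtain g s where g: "g \<in> charts X" "g s = p" using ex_chart_through_point[OF X p] by (elim bexE exE)
  have "parallel_in_building X g s {0} g s {0}"
    unfolding parallel_in_building_def using g(1)
    by (intro exI[of _ s] exI[of _ 0] bexI[of _ g]) auto
  then have "parallel_cones X \<F> {p} {p}"
    unfolding parallel_cones_def using represents_zero[OF cf g(1), of s] g(2) heart_zero by metis
  then show "parallel_subcone X \<F> {p} G" if "G = {p}"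
    using that by (simp add: parallel_subcone_def)
qed

lemma point_cone:
  assumes X: "affine_building X" and cf: "cone_family (walls X) \<F>" and p: "p \<in> points X"
  shows "{p} \<in> building_cones X \<F>"
proof -
  obtain g s where "g \<in> charts X" "g s = p"
    using ex_chart_through_point[OF X p] by (elim bexE exE)
  then have "represents X \<F> g s {0} {p}"
    using represents_zero[OF cf, of g s] by simp
  then show ?thesis unfolding building_cones_def by (intro CollectI exI)
qed

text \<open>A common parallel subcone of \<open>{p}\<close> and \<open>G\<close> is nonempty and so equal to \<open>{p}\<close>; then \<open>G\<close> is a point
  as well.\<close>

lemma cone_rel_point_iff:
  assumes X: "affine_building X" and cf: "cone_family (walls X) \<F>" and p: "p \<in> points X"
  shows "({p}, G) \<in> cone_rel X \<F> \<longleftrightarrow> G = {p}" and "(G, {p}) \<in> cone_rel X \<F> \<longleftrightarrow> G = {p}"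
proof -
  note sub = parallel_subcone_of_point_iff[OF X cf p]
  have below: "H = {p}" if "H \<in> building_cones X \<F>" "parallel_subcone X \<F> H {p}" for H
    using building_cone_nonempty[OF cf that(1)] that(2)
    by (simp add: parallel_subcone_def subset_singleton_iff)
  have refl: "({p}, {p}) \<in> cone_rel X \<F>"
    using point_cone[OF X cf p] sub[of "{p}"] unfolding cone_rel_def by auto
  have "G = {p}" if rel: "({p}, G) \<in> cone_rel X \<F> \<or> (G, {p}) \<in> cone_rel X \<F>"
  proof -
    obtain H where "H \<in> building_cones X \<F>" "parallel_subcone X \<F> H {p}" "parallel_subcone X \<F> H G"
      using rel unfolding cone_rel_def by auto
    then show ?thesis using below[of H] sub[of G] by simp
  qed
  then show "({p}, G) \<in> cone_rel X \<F> \<longleftrightarrow> G = {p}" and "(G, {p}) \<in> cone_rel X \<F> \<longleftrightarrow> G = {p}"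
    using refl by auto
qed

lemma canonical_injection_eq:
  assumes "affine_building X" "cone_family (walls X) \<F>" "p \<in> points X"
  shows "canonical_injection X \<F> p = {{p}}"
  using cone_rel_point_iff(1)[OF assms] by (auto simp: canonical_injection_def)

lemma canonical_injection_in_compactified:
  assumes "affine_building X" "cone_family (walls X) \<F>" "p \<in> points X"
  shows "canonical_injection X \<F> p \<in> compactified X \<F>"
  using point_cone[OF assms] by (auto simp: canonical_injection_def compactified_def quotientI)

lemma point_class_unique:
  assumes "affine_building X" "cone_family (walls X) \<F>" "p \<in> points X"
    and "x \<in> compactified X \<F>" "{p} \<in> x"
  shows "x = canonical_injection X \<F> p"
proof -
  obtain F where "x = cone_rel X \<F> `` {F}"
    using assms(4) by (auto simp: compactified_def elim: quotientE)
  then show ?thesis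
    using assms(5) cone_rel_point_iff(2)[OF assms(1-3)] by (auto simp: canonical_injection_def)
qed

lemma compactified_members: "\<lbrakk>x \<in> compactified X \<F>; F \<in> x\<rbrakk> \<Longrightarrow> F \<in> building_cones X \<F>"
  by (auto simp: compactified_def cone_rel_def elim!: quotientE)

section \<open>Thickened cones and their trace on the building\<close>

lemma cone_thickeningI:
  assumes "represents X \<F> g s f F" "k \<in> charts X" "\<forall>x\<in>heart_base (walls X) s f. k x = g x"
    and y: "y \<in> {x + u | x u. x \<in> g -` F \<and> u \<in> U} \<inter> heart_star (walls X) s f"
  shows "k y \<in> cone_thickening X \<F> F U"
  unfolding cone_thickening_def
  by (rule UnionI[OF _ imageI[OF y]], intro CollectI exI conjI, rule refl) (rule assms)+

lemma cone_thickening_subset_points: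
  assumes "affine_building X"
  shows "cone_thickening X \<F> F U \<subseteq> points X"
  using chart_in_points[OF assms] unfolding cone_thickening_def by blast

lemma canonical_injection_in_basic_nhd_iff:
  assumes "affine_building X" "cone_family (walls X) \<F>" "p \<in> points X"
  shows "canonical_injection X \<F> p \<in> basic_nhd X \<F> F U \<longleftrightarrow> p \<in> cone_thickening X \<F> F U"
  using canonical_injection_in_compactified[OF assms] canonical_injection_eq[OF assms]
  by (simp add: basic_nhd_def)

text \<open>Both the restriction to the star of the heart and the base are trivial for a point: the star is
  everything because the closed chambers, which all contain \<open>0\<close>, cover the space, and the base is
  the point itself.\<close>

lemma cone_thickening_point:
  assumes X: "affine_building X" and cf: "cone_family (walls X) \<F>" and p: "p \<in> points X"
  shows "cone_thickening X \<F> {p} U = {k (s + u) | k s u. k \<in> charts X \<and> k s = p \<and> u \<in> U}"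
proof -
  have base: "heart_base (walls X) s {0} = {s}" for s
    by (auto simp: heart_base_def heart_zero)
  have rep: "represents X \<F> g s f {p} \<longleftrightarrow> g \<in> charts X \<and> f = {0} \<and> g s = p" for g s f
  proof
    assume r: "represents X \<F> g s f {p}"
    then show "g \<in> charts X \<and> f = {0} \<and> g s = p"
      using represents_singleton[OF X cf r] by (simp add: represents_def)
  next
    assume "g \<in> charts X \<and> f = {0} \<and> g s = p"
    then show "represents X \<F> g s f {p}"
      using represents_zero[OF cf, of g s] by simp
  qed
  have pre: "g -` {g s} = {s}" if "g \<in> charts X" for g s
    using chart_inj[OF X that] by (auto simp: inj_def)
  have star: "heart_star (walls X) s {0} = UNIV" for s
    using heart_star_zero affine_building_wall_system[OF X] .
  show ?thesis
  proof (intro equalityI subsetI)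
    fix q assume "q \<in> cone_thickening X \<F> {p} U"
    then obtain g s f k where *: "represents X \<F> g s f {p}" "k \<in> charts X"
        "\<forall>x\<in>heart_base (walls X) s f. k x = g x"
      and q: "q \<in> k ` ({x + u | x u. x \<in> g -` {p} \<and> u \<in> U} \<inter> heart_star (walls X) s f)"
      unfolding cone_thickening_def
      by (elim UnionE CollectE exE conjE) (rule that; simp only:)
    have g: "g \<in> charts X" "f = {0}" "g s = p"
      using *(1) rep by auto
    have "k s = p" using *(3) base g by simp
    moreover have "g -` {p} = {s}" using pre[OF g(1), of s] g(3) by simp
    then obtain u where "u \<in> U" "q = k (s + u)" using q by auto
    ultimately show "q \<in> {k (s + u) | k s u. k \<in> charts X \<and> k s = p \<and> u \<in> U}"
      using *(2) by auto
  next
    fix q assume "q \<in> {k (s + u) | k s u. k \<in> charts X \<and> k s = p \<and> u \<in> U}"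
    then obtain k s u where k: "q = k (s + u)" "k \<in> charts X" "k s = p" "u \<in> U"
      by auto
    have "represents X \<F> k s {0} {p}" using rep k by simp
    moreover have "s + u \<in> {x + u | x u. x \<in> k -` {p} \<and> u \<in> U} \<inter> heart_star (walls X) s {0}"
      using k star by auto
    ultimately show "q \<in> cone_thickening X \<F> {p} U"
      unfolding k(1) using cone_thickeningI[OF _ k(2)] by simp
  qed
qed

text \<open>A chart through \<open>p\<close> and \<open>q\<close> is an isometry, so it exhibits \<open>q\<close> in the thickening as soon as
  \<open>q\<close> is close to \<open>p\<close>.\<close>

lemma cone_thickening_point_ball:
  assumes X: "affine_building X" and cf: "cone_family (walls X) \<F>" and p: "p \<in> points X"
  shows "cone_thickening X \<F> {p} (ball 0 r) = Metric_space.mball (points X) (bdist X) p r"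
proof -
  interpret Metric_space "points X" "bdist X"
    using X by (rule affine_building_metric)
  have "k (s + u) \<in> mball p r" if "k \<in> charts X" "k s = p" "u \<in> ball 0 r" for k s u
    using that chart_dist[OF X that(1), of s "s + u"] chart_in_points[OF X that(1)] p
    by (simp add: dist_norm)
  moreover have "\<exists>k s u. q = k (s + u) \<and> k \<in> charts X \<and> k s = p \<and> u \<in> ball 0 r"
    if "q \<in> mball p r" for q
  proof -
    have q: "q \<in> points X" "bdist X p q < r" using that by auto
    obtain k s t where k: "k \<in> charts X" "k s = p" "k t = q"
      using ex_chart_through_two_points[OF X p q(1)] by blast
    then have "t - s \<in> ball 0 r"
      using q(2) chart_dist[OF X k(1), of s t] by (simp add: dist_norm norm_minus_commute)
    then show ?thesis using k by (metis add.commute diff_add_cancel)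
  qed
  ultimately show ?thesis
    unfolding cone_thickening_point[OF X cf p] by blast
qed

lemma cone_thickening_mono: "U \<subseteq> U' \<Longrightarrow> cone_thickening X \<F> F U \<subseteq> cone_thickening X \<F> F U'"
  unfolding cone_thickening_def by blast

lemma mball_subset_cone_thickening_point:
  assumes X: "affine_building X" and cf: "cone_family (walls X) \<F>" and p: "p \<in> points X"
    and U: "U \<in> stable_nhds (walls X)"
  shows "\<exists>r>0. Metric_space.mball (points X) (bdist X) p r \<subseteq> cone_thickening X \<F> {p} U"
proof -
  obtain r where "0 < r" "ball 0 r \<subseteq> U"
    using U mem_interior[of 0 U] by (auto simp: stable_nhds_def)
  then show ?thesis
    using cone_thickening_mono[of "ball 0 r" U X \<F> "{p}"] cone_thickening_point_ball[OF X cf p] by metis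
qed

text \<open>No ideal point is close to a point of the building: a representative contained in a ball is
  bounded, so it is a point.\<close>

lemma basic_nhd_point_ball_subset:
  assumes X: "affine_building X" and cf: "cone_family (walls X) \<F>" and p: "p \<in> points X"
  shows "basic_nhd X \<F> {p} (ball 0 r) \<subseteq>
    canonical_injection X \<F> ` Metric_space.mball (points X) (bdist X) p r"
proof
  interpret Metric_space "points X" "bdist X"
    using X by (rule affine_building_metric)
  fix x assume "x \<in> basic_nhd X \<F> {p} (ball 0 r)"
  then obtain G where x: "x \<in> compactified X \<F>" "G \<in> x" and G: "G \<subseteq> mball p r"
    unfolding basic_nhd_def cone_thickening_point_ball[OF X cf p] by blast
  obtain g s f where "represents X \<F> g s f G"
    using compactified_members[OF x] unfolding building_cones_def by blast
  moreover have "bdist X p q \<le> r" if "q \<in> G" for q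
    using G that by auto
  ultimately have "G = {g s}"
    using building_cone_in_ball_is_point(2)[OF X cf _ p] by blast
  then have "g s \<in> mball p r" "x = canonical_injection X \<F> (g s)"
    using G x point_class_unique[OF X cf] by auto
  then show "x \<in> canonical_injection X \<F> ` mball p r" by blast
qed

lemma cone_thickening_nonempty:
  assumes X: "affine_building X" and cf: "cone_family (walls X) \<F>"
    and F: "F \<in> building_cones X \<F>" and U: "0 \<in> U"
  shows "cone_thickening X \<F> F U \<noteq> {}"
proof -
  obtain g s f where rep: "represents X \<F> g s f F"
    using F by (auto simp: building_cones_def)
  have g: "g \<in> charts X" and f: "f \<in> \<F>" using rep by (auto simp: represents_def)
  obtain y where y: "y \<in> (+) s ` f" "y \<in> heart_star (walls X) s f"
    using cone_meets_heart_star[OF affine_building_wall_system[OF X] cf f] by blast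
  have "y \<in> {x + u | x u. x \<in> g -` F \<and> u \<in> U}"
    using y(1) represents_image_subset[OF rep] U by (intro CollectI exI[of _ y] exI[of _ 0]) auto
  then have "g y \<in> cone_thickening X \<F> F U"
    using cone_thickeningI[OF rep g] y(2) by simp
  then show ?thesis by blast
qed

section \<open>The embedding of the building\<close>

theorem proposition6p5p1:
  fixes X :: "('p, 'a::euclidean_space) building"
    and \<F> :: "'a set set"
    and T :: "'p set set topology"
  assumes "affine_building X"
    and "cone_family (walls X) \<F>"
    and "cone_topology X \<F> T"
  shows "canonical_injection X \<F> ` points X \<subseteq> compactified X \<F> \<and>
    inj_on (canonical_injection X \<F>) (points X) \<and>
    (\<forall>U\<in>stable_nhds (walls X). \<forall>F\<in>building_cones X \<F>.
       {x\<in>points X. canonical_injection X \<F> x \<in> basic_nhd X \<F> F U} = cone_thickening X \<F> F U) \<and>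
    continuous_map (building_topology X) T (canonical_injection X \<F>) \<and>
    open_map (building_topology X) T (canonical_injection X \<F>) \<and>
    T closure_of (canonical_injection X \<F> ` points X) = compactified X \<F>"
proof -
  let ?\<iota> = "canonical_injection X \<F>" and ?P = "points X"
  note inst = assms(1,2)
  interpret Metric_space ?P "bdist X"
    using assms(1) by (rule affine_building_metric)
  have top: "topspace T = compactified X \<F>"
    and nhd_open: "\<And>x F U. \<lbrakk>x \<in> compactified X \<F>; F \<in> x; U \<in> stable_nhds (walls X)\<rbrakk>
      \<Longrightarrow> \<exists>S. openin T S \<and> x \<in> S \<and> S \<subseteq> basic_nhd X \<F> F U"
    and open_nhd: "\<And>x S. \<lbrakk>x \<in> compactified X \<F>; openin T S; x \<in> S\<rbrakk>
      \<Longrightarrow> \<exists>F\<in>x. \<exists>U\<in>stable_nhds (walls X). basic_nhd X \<F> F U \<subseteq> S"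
    using assms(3) unfolding cone_topology_def by meson+
  have into: "?\<iota> ` ?P \<subseteq> compactified X \<F>"
    using canonical_injection_in_compactified[OF inst] by blast
  have inj: "inj_on ?\<iota> ?P"
    using canonical_injection_eq[OF inst] by (simp add: inj_on_def)
  have trace: "{x\<in>?P. ?\<iota> x \<in> basic_nhd X \<F> F U} = cone_thickening X \<F> F U" for F U
    using canonical_injection_in_basic_nhd_iff[OF inst] cone_thickening_subset_points[OF assms(1)]
    by blast
  have "continuous_map mtopology T ?\<iota>"
    unfolding continuous_map_def
  proof (intro conjI allI impI)
    show "?\<iota> \<in> topspace mtopology \<rightarrow> topspace T" using into top by auto
    fix S assume S: "openin T S"
    have "\<exists>r>0. mball p r \<subseteq> {x\<in>?P. ?\<iota> x \<in> S}" if p: "p \<in> ?P" "?\<iota> p \<in> S" for p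
    proof -
      have "?\<iota> p \<in> compactified X \<F>" using into p(1) by blast
      then obtain U where U: "U \<in> stable_nhds (walls X)" "basic_nhd X \<F> {p} U \<subseteq> S"
        using open_nhd[OF _ S p(2)] unfolding canonical_injection_eq[OF inst p(1)] by auto
      then obtain r where "0 < r" "mball p r \<subseteq> cone_thickening X \<F> {p} U"
        using mball_subset_cone_thickening_point[OF inst p(1)] by blast
      then show ?thesis using U(2) trace[of "{p}" U] by blast
    qed
    then show "openin mtopology {x \<in> topspace mtopology. ?\<iota> x \<in> S}"
      by (auto simp: openin_mtopology)
  qed
  moreover have "open_map mtopology T ?\<iota>"
    unfolding open_map_def
  proof (intro allI impI)
    fix W assume W: "openin mtopology W"
    have "\<exists>S. openin T S \<and> ?\<iota> p \<in> S \<and> S \<subseteq> ?\<iota> ` W" if pW: "p \<in> W" for p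
    proof -
      have p: "p \<in> ?P" using W pW by (auto simp: openin_mtopology)
      obtain r where r: "0 < r" "mball p r \<subseteq> W"
        using W pW by (auto simp: openin_mtopology)
      obtain S where "openin T S" "?\<iota> p \<in> S" "S \<subseteq> basic_nhd X \<F> {p} (ball 0 r)"
        using nhd_open[of "?\<iota> p" "{p}" "ball 0 r"] canonical_injection_in_compactified[OF inst p]
          ball_in_stable_nhds[OF r(1)] unfolding canonical_injection_eq[OF inst p] by blast
      then show ?thesis using basic_nhd_point_ball_subset[OF inst p, of r] r(2) by blast
    qed
    then show "openin T (?\<iota> ` W)"
      by (subst openin_subopen) blast
  qed
  moreover have "T closure_of (?\<iota> ` ?P) = compactified X \<F>"
  proof -
    have "\<exists>p\<in>?P. ?\<iota> p \<in> S" if S: "x \<in> compactified X \<F>" "openin T S" "x \<in> S" for x S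
    proof -
      obtain F U where FU: "F \<in> x" "U \<in> stable_nhds (walls X)" "basic_nhd X \<F> F U \<subseteq> S"
        using open_nhd[OF S] by blast
      have "0 \<in> U" using FU(2) interior_subset by (auto simp: stable_nhds_def)
      then obtain p where "p \<in> cone_thickening X \<F> F U"
        using cone_thickening_nonempty[OF inst compactified_members[OF S(1) FU(1)]] by blast
      then show ?thesis using trace[of F U] FU(3) by blast
    qed
    then have "x \<in> T closure_of (?\<iota> ` ?P)" if "x \<in> compactified X \<F>" for x
      using that top by (auto simp: in_closure_of)
    moreover have "T closure_of (?\<iota> ` ?P) \<subseteq> compactified X \<F>"
      using closure_of_subset_topspace[of T] top by simp
    ultimately show ?thesis by (intro equalityI subsetI) auto
  qed
  ultimately show ?thesis using into inj trace by blast
qed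

end
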